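(* For every $k\in\mathbb{N}$ and every $\alpha\in\Omega$, $[\![\phi_k(\alpha)]\!]=\boldsymbol{\phi}_k([\![\alpha]\!])$.
   Context: Constructive ordinals: $\Omega$ is the set of infinitary terms generated by $0$, successor $\alpha+1$, and limits $\langle\alpha_i\rangle_{i\in\mathbb{N}}$. $o(0)=0$, $o(n+1)=o(n)+1$, $\omega=\langle o(i+1)\rangle_i$. Arithmetic: $\alpha+0=\alpha$, $\alpha+(\beta+1)=(\alpha+\beta)+1$, $\alpha+\langle\beta_i\rangle=\langle\alpha+\beta_i\rangle$; $\alpha\cdot0=0$, $\alpha\cdot(\beta+1)=\alpha\cdot\beta+\alpha$, $\alpha\cdot\langle\beta_i\rangle=\langle\alpha\cdot\beta_i\rangle$; $\alpha^0=o(1)$, $\alpha^{\beta+1}=\alpha^\beta\cdot\alpha$, $\alpha^{\langle\beta_i\rangle}=\langle\alpha^{\beta_i}\rangle$. Constructive Veblen functions: $\phi_0(\gamma)=\omega^\gamma$; $\phi_{k+1}(0)=\langle\phi_k^{(i)}(0)\rangle_i$; $\phi_{k+1}(\gamma+1)=\langle\phi_k^{(i)}(\phi_{k+1}(\gamma)+1)\rangle_i$; $\phi_{k+1}(\langle\gamma_i\rangle)=\langle\phi_{k+1}(\gamma_i)\rangle_i$ ($\phi_k^{(i)}$ the $i$-fold iterate). The map $[\![-]\!]:\Omega\to\mathbf{On}$ into set-theoretic ordinals: $[\![0]\!]=\mathbf{0}$, $[\![\alpha+1]\!]=[\![\alpha]\!]+\mathbf{1}$, $[\![\langle\alpha_i\rangle]\!]=\bigcup_i[\![\alpha_i]\!]$.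 Set-theoretic Veblen functions $\boldsymbol{\phi}_k:\mathbf{On}\to\mathbf{On}$: $\boldsymbol{\phi}_0(\boldsymbol\alpha)=\boldsymbol\omega^{\boldsymbol\alpha}$; $\boldsymbol{\phi}_{k+1}(\mathbf 0)$ is the least fixed point of $\boldsymbol\phi_k$; $\boldsymbol\phi_{k+1}(\boldsymbol\alpha+\mathbf1)$ is the least fixed point of $\boldsymbol\phi_k$ strictly greater than $\boldsymbol\phi_{k+1}(\boldsymbol\alpha)$; $\boldsymbol\phi_{k+1}(\boldsymbol\alpha)=\bigcup_{\boldsymbol\beta<\boldsymbol\alpha}\boldsymbol\phi_{k+1}(\boldsymbol\beta)$ for limit $\boldsymbol\alpha$. *)

theory Defs
  imports Complex_Main "HOL-Library.Infinite_Typeclass"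
begin

unbundle cardinal_syntax

section \<open>Constructive ordinals\<close>

text \<open>The sequence in a limit term is arbitrary; it need not be increasing.\<close>

datatype cord = Zero | Succ cord | Lim "nat \<Rightarrow> cord"

primrec cord_of_nat :: "nat \<Rightarrow> cord" where
  "cord_of_nat 0 = Zero"
| "cord_of_nat (Suc n) = Succ (cord_of_nat n)"

definition c_omega :: cord where
  "c_omega = Lim (\<lambda>i. cord_of_nat (i + 1))"

instantiation cord :: "{plus, times}"
begin

primrec plus_cord :: "cord \<Rightarrow> cord \<Rightarrow> cord" where
  "\<alpha> + Zero = \<alpha>"
| "\<alpha> + Succ \<beta> = Succ (\<alpha> + \<beta>)"
| "\<alpha> + Lim \<beta> = Lim (\<lambda>i. \<alpha> + \<beta> i)"

primrec times_cord :: "cord \<Rightarrow> cord \<Rightarrow> cord" where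
  "\<alpha> * Zero = Zero"
| "\<alpha> * Succ \<beta> = \<alpha> * \<beta> + \<alpha>"
| "\<alpha> * Lim \<beta> = Lim (\<lambda>i. \<alpha> * \<beta> i)"

instance ..

end

primrec c_pow :: "cord \<Rightarrow> cord \<Rightarrow> cord" where
  "c_pow \<alpha> Zero = cord_of_nat 1"
| "c_pow \<alpha> (Succ \<beta>) = c_pow \<alpha> \<beta> * \<alpha>"
| "c_pow \<alpha> (Lim \<beta>) = Lim (\<lambda>i. c_pow \<alpha> (\<beta> i))"

text \<open>One step of the Veblen hierarchy: from \<open>\<phi>\<^sub>k\<close> to \<open>\<phi>\<^bsub>k+1\<^esub>\<close>.\<close>

primrec c_veblen_step :: "(cord \<Rightarrow> cord) \<Rightarrow> cord \<Rightarrow> cord" where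
  "c_veblen_step f Zero = Lim (\<lambda>i. (f ^^ i) Zero)"
| "c_veblen_step f (Succ \<gamma>) = Lim (\<lambda>i. (f ^^ i) (Succ (c_veblen_step f \<gamma>)))"
| "c_veblen_step f (Lim \<gamma>) = Lim (\<lambda>i. c_veblen_step f (\<gamma> i))"

primrec c_veblen :: "nat \<Rightarrow> cord \<Rightarrow> cord" where
  "c_veblen 0 = c_pow c_omega"
| "c_veblen (Suc k) = c_veblen_step (c_veblen k)"

lemma c_veblen_simps:
  "c_veblen 0 \<gamma> = c_pow c_omega \<gamma>"
  "c_veblen (Suc k) Zero = Lim (\<lambda>i. (c_veblen k ^^ i) Zero)"
  "c_veblen (Suc k) (Succ \<gamma>) = Lim (\<lambda>i. (c_veblen k ^^ i) (Succ (c_veblen (Suc k) \<gamma>)))"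
  "c_veblen (Suc k) (Lim \<delta>) = Lim (\<lambda>i. c_veblen (Suc k) (\<delta> i))"
  by simp_all


section \<open>Set-theoretic ordinals\<close>

text \<open>
  HOL has no type of all ordinals. For an infinite type \<open>'a\<close> of cardinality \<open>\<kappa>\<close>, the type
  \<open>'a ordinal\<close> consists of the order types of all well-orders on subsets of \<open>'a\<close>; it is the
  initial segment of the class of ordinals below the regular cardinal \<open>\<kappa>\<^sup>+\<close>. As \<open>'a\<close> ranges over
  all infinite types, these segments cover all the ordinals available in HOL. Each of
  them is closed under successors, suprema of at most \<open>\<kappa>\<close> elements (lemma
  \<open>small_strictly_bounded\<close>), ordinal arithmetic and the Veblen functions, so on it these notions
  are the restrictions of the class-sized ones.
\<close>

quotient_type (overloaded) 'a ordinal = "('a::infinite) rel" / partial: "\<lambda>r s. r =o s"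
  morphisms rep_ordinal abs_ordinal
proof (rule part_equivpI)
  show "\<exists>r::'a rel. r =o r"
    using card_of_refl by blast
  show "symp (\<lambda>r s::'a rel. r =o s)"
    by (auto intro: sympI ordIso_symmetric)
  show "transp (\<lambda>r s::'a rel. r =o s)"
    by (auto intro: transpI ordIso_transitive)
qed

lemma ordIso_self_iff: "r =o r \<longleftrightarrow> Well_order r"
  by (auto simp: ordIso_reflexive) (auto simp: ordIso_def)

instantiation ordinal :: (infinite) linorder
begin

lift_definition less_eq_ordinal :: "'a ordinal \<Rightarrow> 'a ordinal \<Rightarrow> bool" is "\<lambda>r s. r \<le>o s"
  by (meson ordIso_ordLeq_trans ordIso_symmetric ordLeq_ordIso_trans)

lift_definition less_ordinal :: "'a ordinal \<Rightarrow> 'a ordinal \<Rightarrow> bool" is "\<lambda>r s. r <o s"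
  by (meson ordIso_ordLess_trans ordIso_symmetric ordLess_ordIso_trans)

instance
proof
  fix x y z :: "'a ordinal"
  show "x < y \<longleftrightarrow> x \<le> y \<and> \<not> y \<le> x"
    by transfer (metis ordIso_self_iff not_ordLeq_iff_ordLess ordLess_imp_ordLeq)
  show "x \<le> x"
    by transfer (simp add: ordIso_imp_ordLeq)
  show "x \<le> y \<Longrightarrow> y \<le> z \<Longrightarrow> x \<le> z"
    by transfer (rule ordLeq_transitive)
  show "x \<le> y \<Longrightarrow> y \<le> x \<Longrightarrow> x = y"
    by transfer (simp add: ordIso_iff_ordLeq)
  show "x \<le> y \<or> y \<le> x"
    by transfer (metis ordIso_self_iff ordLeq_total)
qed

end

instance ordinal :: (infinite) wellorder
proof
  fix P :: "'a ordinal \<Rightarrow> bool" and a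
  assume step: "\<And>x. (\<And>y. y < x \<Longrightarrow> P y) \<Longrightarrow> P x"
  have "\<forall>a. r =o r \<longrightarrow> a = abs_ordinal r \<longrightarrow> P a" for r :: "'a rel"
  proof (induction r rule: wf_induct_rule[OF wf_ordLess])
    case (1 r)
    show ?case
    proof (intro allI impI)
      fix a assume r: "r =o r" and a: "a = abs_ordinal r"
      show "P a"
      proof (rule step)
        fix y assume "y < a"
        define s where "s = rep_ordinal y"
        have s: "s =o s" "y = abs_ordinal s"
          using Quotient3_rep_reflp[OF Quotient3_ordinal, of y]
            Quotient3_abs_rep[OF Quotient3_ordinal, of y] by (simp_all add: s_def)
        then have "s <o r"
          using \<open>y < a\<close> a less_ordinal.abs_eq[OF s(1) r] by simp
        with 1 s show "P y" by blast
      qed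
    qed
  qed
  then show "P a"
    using Quotient3_rep_reflp[OF Quotient3_ordinal, of a]
      Quotient3_abs_rep[OF Quotient3_ordinal, of a] by metis
qed

instantiation ordinal :: (infinite) conditionally_complete_linorder
begin

definition inf_ordinal :: "'a ordinal \<Rightarrow> 'a ordinal \<Rightarrow> 'a ordinal" where
  "inf_ordinal = min"

definition sup_ordinal :: "'a ordinal \<Rightarrow> 'a ordinal \<Rightarrow> 'a ordinal" where
  "sup_ordinal = max"

definition Inf_ordinal :: "'a ordinal set \<Rightarrow> 'a ordinal" where
  "Inf (A :: 'a ordinal set) = (LEAST \<alpha>. \<alpha> \<in> A)"

text \<open>The union of a set of (von Neumann) ordinals is its least upper bound.\<close>

definition Sup_ordinal :: "'a ordinal set \<Rightarrow> 'a ordinal" where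
  "Sup (A :: 'a ordinal set) = (LEAST \<beta>. \<forall>\<alpha>\<in>A. \<alpha> \<le> \<beta>)"

instance
proof
  fix x z :: "'a ordinal" and A :: "'a ordinal set"
  show "x \<in> A \<Longrightarrow> bdd_below A \<Longrightarrow> Inf A \<le> x"
    unfolding Inf_ordinal_def by (rule Least_le)
  show "z \<le> Inf A" if "A \<noteq> {}" "\<And>x. x \<in> A \<Longrightarrow> z \<le> x"
    unfolding Inf_ordinal_def using that by (metis LeastI_ex ex_in_conv)
  show "x \<le> Sup A" if "x \<in> A" "bdd_above A"
  proof -
    have "\<forall>\<alpha>\<in>A. \<alpha> \<le> Sup A"
      unfolding Sup_ordinal_def by (rule LeastI_ex) (use that in \<open>auto simp: bdd_above_def\<close>)
    with that show ?thesis by blast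
  qed
  show "Sup A \<le> z" if "A \<noteq> {}" "\<And>x. x \<in> A \<Longrightarrow> x \<le> z"
    unfolding Sup_ordinal_def by (rule Least_le) (use that in auto)
qed (auto simp: inf_ordinal_def sup_ordinal_def)

end

lemma small_strictly_bounded:
  fixes A :: "'a::infinite ordinal set"
  assumes "|A| \<le>o |UNIV :: 'a set|"
  shows "\<exists>\<beta>. \<forall>\<alpha>\<in>A. \<alpha> < \<beta>"
proof -
  let ?U = "|UNIV :: 'a set|"
  let ?K = "cardSuc ?U"
  have CU: "Card_order ?U" by (rule card_of_Card_order)
  have CK: "Card_order ?K" using CU by (rule cardSuc_Card_order)
  have WK: "Well_order ?K" using CU by (rule cardSuc_Well_order)
  have infK: "infinite (Field ?K)"
    using CU cardSuc_finite[OF CU] infinite_UNIV by (simp add: Field_card_of)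
  have regK: "regularCard ?K"
    using CU by (intro infinite_cardSuc_regularCard) (simp_all add: Field_card_of infinite_UNIV)
  have small: "r <o ?K" if "Well_order r" for r :: "'a rel"
  proof (rule ccontr)
    assume "\<not> r <o ?K"
    with that WK have "?K \<le>o r" by (simp add: not_ordLess_iff_ordLeq)
    then have "|Field ?K| \<le>o |Field r|" by (rule card_of_mono2)
    also have "|Field r| \<le>o ?U" by (rule card_of_mono1) simp
    finally have "?K \<le>o ?U"
      using card_of_Field_ordIso[OF CK] ordIso_ordLeq_trans ordIso_symmetric by blast
    then show False using cardSuc_greater[OF CU] not_ordLess_ordLeq by blast
  qed
  have WR: "Well_order (rep_ordinal \<alpha>)" for \<alpha> :: "'a ordinal"
    using Quotient3_rep_reflp[OF Quotient3_ordinal, of \<alpha>] by (simp add: ordIso_self_iff)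
  have "\<exists>a\<in>Field ?K. rep_ordinal \<alpha> =o Restr ?K (underS ?K a)" for \<alpha> :: "'a ordinal"
    using small[OF WR] ordLess_iff_ordIso_Restr[OF WK WR] by blast
  then obtain f where f: "\<And>\<alpha>. f \<alpha> \<in> Field ?K"
    "\<And>\<alpha>::'a ordinal. rep_ordinal \<alpha> =o Restr ?K (underS ?K (f \<alpha>))"
    by metis
  have "|f ` A| \<le>o ?U"
    using card_of_image assms ordLeq_transitive by blast
  then have "|f ` A| <o ?K"
    using cardSuc_greater[OF CU] ordLeq_ordLess_trans by blast
  then have "\<not> cofinal (f ` A) ?K"
    using regK f(1) not_ordLess_ordIso unfolding regularCard_def by blast
  then obtain a where a: "a \<in> Field ?K" "\<And>\<alpha>. \<alpha> \<in> A \<Longrightarrow> f \<alpha> = a \<or> (a, f \<alpha>) \<notin> ?K"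
    unfolding cofinal_def by blast
  obtain b where b: "b \<in> Field ?K" "a \<noteq> b" "(a, b) \<in> ?K"
    using infinite_Card_order_limit[OF CK infK a(1)] by blast
  let ?T = "Restr ?K (underS ?K b)"
  have woK: "wo_rel ?K" using WK by (simp add: wo_rel_def)
  have lt: "rep_ordinal \<alpha> <o ?T" if "\<alpha> \<in> A" for \<alpha>
  proof -
    have "(f \<alpha>, a) \<in> ?K"
      using a that f(1)[of \<alpha>] wo_rel.TOTALS[OF woK] wo_rel.REFL[OF woK]
      by (metis refl_onD)
    then have sub: "underS ?K (f \<alpha>) \<subseteq> underS ?K a"
      using wo_rel.TRANS[OF woK] wo_rel.ANTISYM[OF woK] by (intro underS_incr)
    have "underS ?K a \<subset> underS ?K b"
      using b wo_rel.TRANS[OF woK] wo_rel.ANTISYM[OF woK] underS_incr[of ?K a b]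
      by (auto simp: underS_def)
    with sub have "underS ?K (f \<alpha>) \<subset> underS ?K b" by blast
    then have "Restr ?K (underS ?K (f \<alpha>)) <o ?T"
      using ofilter_subset_ordLess[OF WK] wo_rel.underS_ofilter[OF woK] by blast
    with f(2) show ?thesis using ordIso_ordLess_trans by blast
  qed
  have WT: "Well_order ?T" using WK by (rule Well_order_Restr)
  have "?T <o ?K" using WK b(1) by (intro underS_Restr_ordLess) auto
  then have "|Field ?T| <o ?K"
    using card_of_least[of "Field ?T" ?T] WT ordLeq_ordLess_trans by blast
  then have "|Field ?T| \<le>o ?U"
    using cardSuc_ordLess_ordLeq[OF CU card_of_Card_order] cardSuc_ordLeq_ordLess[OF CU card_of_Card_order]
      not_ordLess_ordLeq ordLess_or_ordLeq[OF card_of_Well_order card_of_Well_order] by metis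
  then obtain g :: "_ \<Rightarrow> 'a" where g: "inj_on g (Field ?T)"
    unfolding card_of_ordLeq[symmetric] by blast
  let ?S = "dir_image ?T g"
  have TS: "?T =o ?S" using WT g by (rule dir_image_ordIso)
  then have SS: "?S =o ?S" using ordIso_symmetric ordIso_transitive by blast
  have "\<alpha> < abs_ordinal ?S" if "\<alpha> \<in> A" for \<alpha>
  proof -
    have "rep_ordinal \<alpha> <o ?S" using lt[OF that] TS ordLess_ordIso_trans by blast
    then have "abs_ordinal (rep_ordinal \<alpha>) < abs_ordinal ?S"
      using less_ordinal.abs_eq[OF Quotient3_rep_reflp[OF Quotient3_ordinal] SS] by blast
    then show ?thesis by (simp add: Quotient3_abs_rep[OF Quotient3_ordinal])
  qed
  then show ?thesis by blast
qed

lemma countable_strictly_bounded: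
  fixes f :: "nat \<Rightarrow> 'a::infinite ordinal"
  shows "\<exists>\<beta>. \<forall>i. f i < \<beta>"
proof -
  have "|range f| \<le>o |UNIV :: nat set|" by (rule card_of_image)
  also have "|UNIV :: nat set| \<le>o |UNIV :: 'a set|"
    using infinite_UNIV infinite_iff_card_of_nat by blast
  finally show ?thesis using small_strictly_bounded by blast
qed

instantiation ordinal :: (infinite) zero
begin

lift_definition zero_ordinal :: "'a ordinal" is "{}"
  by (simp add: ordIso_self_iff)

instance ..

end

definition osuc :: "'a::infinite ordinal \<Rightarrow> 'a ordinal" where
  "osuc \<alpha> = (LEAST \<beta>. \<alpha> < \<beta>)"

lemma zero_le_ordinal [simp]: "0 \<le> (\<alpha> :: 'a::infinite ordinal)"
  by transfer (simp add: ordIso_self_iff ordLeq_iff_ordLess_Restr)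

lemma less_osuc: "\<alpha> < osuc \<alpha>"
  unfolding osuc_def by (rule LeastI_ex) (use countable_strictly_bounded[of "\<lambda>_. \<alpha>"] in blast)

lemma less_osuc_iff: "\<alpha> < osuc \<beta> \<longleftrightarrow> \<alpha> \<le> \<beta>"
  using less_osuc[of \<beta>] not_less_Least[of \<alpha> "\<lambda>\<gamma>. \<beta> < \<gamma>"] unfolding osuc_def by fastforce

lemma osuc_inject [simp]: "osuc \<alpha> = osuc \<beta> \<longleftrightarrow> \<alpha> = \<beta>"
  by (metis less_osuc less_osuc_iff order_antisym)

lemma osuc_neq_zero [simp]: "osuc \<alpha> \<noteq> 0"
  using less_osuc[of \<alpha>] zero_le_ordinal[of \<alpha>] by (metis not_le)

definition is_limit :: "'a::infinite ordinal \<Rightarrow> bool" where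
  "is_limit \<alpha> \<longleftrightarrow> \<alpha> \<noteq> 0 \<and> (\<nexists>\<beta>. \<alpha> = osuc \<beta>)"

text \<open>Transfinite recursion: value \<open>z\<close> at zero, \<open>s\<close> applied to the previous value at successors,
  supremum of all earlier values at limits.\<close>

function trans_rec ::
  "'a::infinite ordinal \<Rightarrow> ('a ordinal \<Rightarrow> 'a ordinal) \<Rightarrow> 'a ordinal \<Rightarrow> 'a ordinal" where
  "trans_rec z s \<alpha> =
    (if \<alpha> = 0 then z
     else if \<exists>\<beta>. \<alpha> = osuc \<beta> then s (trans_rec z s (THE \<beta>. \<alpha> = osuc \<beta>))
     else (SUP \<beta>\<in>{..<\<alpha>}. trans_rec z s \<beta>))"
  by auto
termination
  by (relation "inv_image {(x, y). x < y} (\<lambda>(z, s, \<alpha>). \<alpha>)")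
    (auto simp: wf less_osuc)

declare trans_rec.simps [simp del]

lemma trans_rec_zero: "trans_rec z s 0 = z"
  by (simp add: trans_rec.simps)

lemma trans_rec_osuc: "trans_rec z s (osuc \<alpha>) = s (trans_rec z s \<alpha>)"
  by (subst trans_rec.simps) simp

lemma trans_rec_limit: "is_limit \<alpha> \<Longrightarrow> trans_rec z s \<alpha> = (SUP \<beta>\<in>{..<\<alpha>}. trans_rec z s \<beta>)"
  by (subst trans_rec.simps) (auto simp: is_limit_def)

instantiation ordinal :: (infinite) "{one, plus, times}"
begin

definition one_ordinal :: "'a ordinal" where
  "1 = osuc 0"

definition plus_ordinal :: "'a ordinal \<Rightarrow> 'a ordinal \<Rightarrow> 'a ordinal" where
  "\<alpha> + \<beta> = trans_rec \<alpha> osuc \<beta>"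

definition times_ordinal :: "'a ordinal \<Rightarrow> 'a ordinal \<Rightarrow> 'a ordinal" where
  "\<alpha> * \<beta> = trans_rec 0 (\<lambda>\<gamma>. \<gamma> + \<alpha>) \<beta>"

instance ..

end

definition ord_pow :: "'a::infinite ordinal \<Rightarrow> 'a ordinal \<Rightarrow> 'a ordinal" where
  "ord_pow \<alpha> \<beta> = trans_rec 1 (\<lambda>\<gamma>. \<gamma> * \<alpha>) \<beta>"

definition ord_omega :: "'a::infinite ordinal" where
  "ord_omega = (LEAST \<alpha>. is_limit \<alpha>)"

primrec veblen :: "nat \<Rightarrow> 'a::infinite ordinal \<Rightarrow> 'a ordinal" where
  "veblen 0 = ord_pow ord_omega"
| "veblen (Suc k) =
     trans_rec (LEAST \<beta>. veblen k \<beta> = \<beta>) (\<lambda>\<gamma>. LEAST \<beta>. \<gamma> < \<beta> \<and> veblen k \<beta> = \<beta>)"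

lemma plus_one_ordinal: "\<alpha> + 1 = osuc (\<alpha> :: 'a::infinite ordinal)"
  by (simp add: one_ordinal_def plus_ordinal_def trans_rec_osuc trans_rec_zero)

lemma plus_ordinal_simps:
  fixes \<alpha> \<beta> :: "'a::infinite ordinal"
  shows "\<alpha> + 0 = \<alpha>"
    and "\<alpha> + (\<beta> + 1) = (\<alpha> + \<beta>) + 1"
    and "is_limit \<beta> \<Longrightarrow> \<alpha> + \<beta> = (SUP \<gamma>\<in>{..<\<beta>}. \<alpha> + \<gamma>)"
  unfolding plus_one_ordinal
  by (simp_all add: plus_ordinal_def trans_rec_zero trans_rec_osuc trans_rec_limit)

lemma times_ordinal_simps:
  fixes \<alpha> \<beta> :: "'a::infinite ordinal"
  shows "\<alpha> * 0 = 0"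
    and "\<alpha> * (\<beta> + 1) = \<alpha> * \<beta> + \<alpha>"
    and "is_limit \<beta> \<Longrightarrow> \<alpha> * \<beta> = (SUP \<gamma>\<in>{..<\<beta>}. \<alpha> * \<gamma>)"
  unfolding plus_one_ordinal
  by (simp_all add: times_ordinal_def trans_rec_zero trans_rec_osuc trans_rec_limit)

lemma ord_pow_simps:
  fixes \<alpha> \<beta> :: "'a::infinite ordinal"
  shows "ord_pow \<alpha> 0 = 1"
    and "ord_pow \<alpha> (\<beta> + 1) = ord_pow \<alpha> \<beta> * \<alpha>"
    and "is_limit \<beta> \<Longrightarrow> ord_pow \<alpha> \<beta> = (SUP \<gamma>\<in>{..<\<beta>}. ord_pow \<alpha> \<gamma>)"
  unfolding plus_one_ordinal
  by (simp_all add: ord_pow_def trans_rec_zero trans_rec_osuc trans_rec_limit)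

lemma veblen_simps:
  fixes \<alpha> :: "'a::infinite ordinal"
  shows "veblen 0 \<alpha> = ord_pow ord_omega \<alpha>"
    and "veblen (Suc k) (0 :: 'a ordinal) = (LEAST \<beta>. veblen k \<beta> = \<beta>)"
    and "veblen (Suc k) (\<alpha> + 1) = (LEAST \<beta>. veblen (Suc k) \<alpha> < \<beta> \<and> veblen k \<beta> = \<beta>)"
    and "is_limit \<alpha> \<Longrightarrow> veblen (Suc k) \<alpha> = (SUP \<beta>\<in>{..<\<alpha>}. veblen (Suc k) \<beta>)"
  unfolding plus_one_ordinal
  by (simp_all add: trans_rec_zero trans_rec_osuc trans_rec_limit)


section \<open>Interpretation of constructive ordinals\<close>

primrec denote :: "cord \<Rightarrow> 'a::infinite ordinal" where
  "denote Zero = 0"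
| "denote (Succ \<alpha>) = denote \<alpha> + 1"
| "denote (Lim \<alpha>) = (SUP i. denote (\<alpha> i))"

end

theory Submission
  imports Defs
begin

text \<open>
  Every function defined by transfinite recursion with an inflationary step commutes with suprema
  of arbitrary (not necessarily increasing) sequences, so its constructive counterpart, which is
  defined by exactly this equation at limit terms, denotes the same function.
  Each \<open>\<phi>\<^sub>k\<close> is moreover strictly increasing, and the least fixed point above \<open>\<alpha>\<close> of such a function
  \<open>F\<close> is the supremum of the iterates \<open>F\<^sup>i(\<alpha>)\<close>, which is how \<open>\<phi>\<^bsub>k+1\<^esub>\<close> is defined constructively.
\<close>

section \<open>Bounds and suprema\<close>

text \<open>Each \<beta> < \<alpha> is isomorphic to the initial segment of
  \<open>rep_ordinal \<alpha>\<close> below some element of \<open>'a\<close>, and that element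
  determines \<beta>. Choosing such elements gives an injection into \<open>'a\<close>.\<close>

lemma card_of_lessThan_ordinal:
  fixes \<alpha> :: "'a::infinite ordinal"
  shows "|{..<\<alpha>}| \<le>o |UNIV :: 'a set|"
proof -
  have refl: "rep_ordinal \<beta> =o rep_ordinal \<beta>" for \<beta> :: "'a ordinal"
    by (rule Quotient3_rep_reflp[OF Quotient3_ordinal])
  have abs: "abs_ordinal (rep_ordinal \<beta>) = \<beta>" for \<beta> :: "'a ordinal"
    by (rule Quotient3_abs_rep[OF Quotient3_ordinal])
  have WR: "Well_order (rep_ordinal \<beta>)" for \<beta> :: "'a ordinal"
    using refl by (simp add: ordIso_self_iff)
  let ?r = "rep_ordinal \<alpha>"
  have "\<exists>a. rep_ordinal \<beta> =o Restr ?r (underS ?r a)" if "\<beta> < \<alpha>" for \<beta>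
  proof -
    have "rep_ordinal \<beta> <o ?r"
      using that less_ordinal.abs_eq[OF refl refl, of \<beta> \<alpha>] by (simp add: abs)
    then show ?thesis
      using ordLess_iff_ordIso_Restr[OF WR WR] by blast
  qed
  then obtain f where f: "\<And>\<beta>. \<beta> < \<alpha> \<Longrightarrow> rep_ordinal \<beta> =o Restr ?r (underS ?r (f \<beta>))"
    by metis
  have "inj_on f {..<\<alpha>}"
  proof (rule inj_onI)
    fix \<beta> \<gamma> assume "\<beta> \<in> {..<\<alpha>}" "\<gamma> \<in> {..<\<alpha>}" "f \<beta> = f \<gamma>"
    then have "rep_ordinal \<beta> =o rep_ordinal \<gamma>"
      using f[of \<beta>] f[of \<gamma>] ordIso_symmetric ordIso_transitive by fastforce
    then have "abs_ordinal (rep_ordinal \<beta>) = abs_ordinal (rep_ordinal \<gamma>)"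
      by (rule Quotient3_rel_abs[OF Quotient3_ordinal])
    then show "\<beta> = \<gamma>" by (simp add: abs)
  qed
  then show ?thesis
    unfolding card_of_ordLeq[symmetric] by blast
qed

text \<open>Ensures that the supremum in the limit clause of \<open>trans_rec\<close> is taken over
  a bounded set, hence is a genuine least upper bound.\<close>

lemma bdd_above_image_lessThan_ordinal:
  fixes F :: "'a::infinite ordinal \<Rightarrow> 'a ordinal"
  shows "bdd_above (F ` {..<\<alpha>})"
proof -
  have "|F ` {..<\<alpha>}| \<le>o |UNIV :: 'a set|"
    using card_of_image card_of_lessThan_ordinal ordLeq_transitive by blast
  from small_strictly_bounded[OF this] show ?thesis
    by (auto simp: bdd_above_def intro: less_imp_le)
qed

lemma bdd_above_range_ordinal [simp]: "bdd_above (range (f :: nat \<Rightarrow> 'a::infinite ordinal))"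
  using countable_strictly_bounded[of f] by (auto simp: bdd_above_def intro: less_imp_le)

lemma le_SUP_ordinal: "f i \<le> (SUP i. f i)" for f :: "nat \<Rightarrow> 'a::infinite ordinal"
  by (rule cSUP_upper) auto

lemma less_SUP_ordinal_iff: "\<alpha> < (SUP i. f i) \<longleftrightarrow> (\<exists>i. \<alpha> < f i)"
  for f :: "nat \<Rightarrow> 'a::infinite ordinal"
  by (subst less_cSUP_iff) auto

lemma osuc_le_iff: "osuc \<alpha> \<le> \<beta> \<longleftrightarrow> \<alpha> < \<beta>"
  using less_osuc_iff[of \<beta> \<alpha>] by (auto simp: not_less[symmetric])

lemma ordinal_cases [case_names zero osuc limit]:
  obtains "\<alpha> = 0" | \<beta> where "\<alpha> = osuc \<beta>" | "is_limit \<alpha>"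
  by (auto simp: is_limit_def)

lemma is_limit_pos: "is_limit \<alpha> \<Longrightarrow> 0 < \<alpha>"
  using zero_le_ordinal[of \<alpha>] by (simp add: is_limit_def less_le del: zero_le_ordinal)

text \<open>If the supremum were \<open>osuc \<beta>\<close>, some term would exceed \<beta> and so
  already reach the supremum.\<close>

lemma is_limit_SUP:
  fixes f :: "nat \<Rightarrow> 'a::infinite ordinal"
  assumes "\<And>i. f i < (SUP i. f i)"
  shows "is_limit (SUP i. f i)"
  unfolding is_limit_def
proof
  show "(SUP i. f i) \<noteq> 0"
    using assms[of 0] zero_le_ordinal[of "f 0"] by (metis not_le)
  show "\<nexists>\<beta>. (SUP i. f i) = osuc \<beta>"
  proof
    assume "\<exists>\<beta>. (SUP i. f i) = osuc \<beta>"
    then obtain \<beta> where \<beta>: "(SUP i. f i) = osuc \<beta>" ..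
    then obtain i where "\<beta> < f i"
      using less_osuc[of \<beta>] less_SUP_ordinal_iff[of \<beta> f] by auto
    with assms[of i] \<beta> show False
      by (simp add: less_osuc_iff)
  qed
qed


section \<open>Sequentially continuous and normal functions\<close>

definition seq_continuous :: "('a::infinite ordinal \<Rightarrow> 'a ordinal) \<Rightarrow> bool" where
  "seq_continuous F \<longleftrightarrow> (\<forall>f :: nat \<Rightarrow> 'a ordinal. F (SUP i. f i) = (SUP i. F (f i)))"

lemma seq_continuousD: "seq_continuous F \<Longrightarrow> F (SUP i. f i) = (SUP i. F (f i))"
  for f :: "nat \<Rightarrow> 'a::infinite ordinal"
  by (simp add: seq_continuous_def)

text \<open>The classical normal functions, with continuity asked for countable suprema: those
  produced by \<open>Lim\<close> and by iteration.\<close>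

definition seq_normal :: "('a::infinite ordinal \<Rightarrow> 'a ordinal) \<Rightarrow> bool" where
  "seq_normal F \<longleftrightarrow> strict_mono F \<and> seq_continuous F"

lemma strict_mono_imp_inflationary:
  fixes F :: "'a::wellorder \<Rightarrow> 'a"
  assumes "strict_mono F"
  shows "x \<le> F x"
proof (induction x rule: less_induct)
  case (less x)
  show ?case
  proof (rule ccontr)
    assume "\<not> x \<le> F x"
    then have "F x < x" by simp
    with less[of "F x"] strict_monoD[OF assms this] show False by simp
  qed
qed

section \<open>Transfinite recursion with an inflationary step\<close>

lemma trans_rec_mono:
  assumes "\<And>\<gamma>. \<gamma> \<le> s \<gamma>"
  shows "mono (trans_rec z s)"
proof (rule monoI)
  fix \<alpha> \<beta> :: "'a ordinal"
  assume "\<alpha> \<le> \<beta>"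
  then show "trans_rec z s \<alpha> \<le> trans_rec z s \<beta>"
  proof (induction \<beta> rule: less_induct)
    case (less \<beta>)
    show ?case
    proof (cases "\<alpha> = \<beta>")
      case False
      with less.prems have "\<alpha> < \<beta>" by simp
      show ?thesis
      proof (cases \<beta> rule: ordinal_cases)
        case zero
        with \<open>\<alpha> < \<beta>\<close> show ?thesis by (simp add: not_le[symmetric])
      next
        case (osuc \<gamma>)
        with \<open>\<alpha> < \<beta>\<close> have "trans_rec z s \<alpha> \<le> trans_rec z s \<gamma>"
          by (intro less.IH) (simp_all add: less_osuc less_osuc_iff)
        also have "\<dots> \<le> trans_rec z s \<beta>"
          using assms by (simp add: osuc trans_rec_osuc)
        finally show ?thesis .
      next
        case limit
        show ?thesis
          unfolding trans_rec_limit[OF limit]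
          using \<open>\<alpha> < \<beta>\<close> by (intro cSUP_upper bdd_above_image_lessThan_ordinal) simp
      qed
    qed simp
  qed
qed

lemma trans_rec_seq_continuous:
  assumes "\<And>\<gamma>. \<gamma> \<le> s \<gamma>"
  shows "seq_continuous (trans_rec z s)"
  unfolding seq_continuous_def
proof (intro allI antisym)
  fix f :: "nat \<Rightarrow> 'a ordinal"
  let ?F = "trans_rec z s" and ?L = "SUP i. f i"
  have mono: "mono ?F" using assms by (rule trans_rec_mono)
  show "(SUP i. ?F (f i)) \<le> ?F ?L"
    by (intro cSUP_least monoD[OF mono] le_SUP_ordinal) simp
  show "?F ?L \<le> (SUP i. ?F (f i))"
  \<comment> \<open>An attained supremum appears among the terms on the right. Otherwise
    \<open>?L\<close> is a limit in which the sequence is cofinal, so the limit clause of the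
    recursion applies.\<close>
  proof (cases "\<exists>i. f i = ?L")
    case True
    then obtain i where "f i = ?L" ..
    then show ?thesis using le_SUP_ordinal[of "\<lambda>i. ?F (f i)" i] by simp
  next
    case False
    then have less: "f i < ?L" for i
      using le_SUP_ordinal[of f i] by (simp add: less_le)
    then have lim: "is_limit ?L" by (rule is_limit_SUP)
    show ?thesis
      unfolding trans_rec_limit[OF lim]
    proof (rule cSUP_least)
      show "{..<?L} \<noteq> {}" using less[of 0] by blast
      fix \<beta> assume "\<beta> \<in> {..<?L}"
      then obtain i where "\<beta> < f i" by (auto simp: less_SUP_ordinal_iff)
      then have "?F \<beta> \<le> ?F (f i)" by (intro monoD[OF mono]) simp
      also have "\<dots> \<le> (SUP i. ?F (f i))" by (rule le_SUP_ordinal)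
      finally show "?F \<beta> \<le> (SUP i. ?F (f i))" .
    qed
  qed
qed

lemma mono_osuc_less_imp_strict_mono:
  fixes F :: "'a::infinite ordinal \<Rightarrow> 'b::order"
  assumes "mono F" and "\<And>\<alpha>. F \<alpha> < F (osuc \<alpha>)"
  shows "strict_mono F"
proof (rule strict_monoI)
  fix \<alpha> \<beta> :: "'a ordinal"
  assume "\<alpha> < \<beta>"
  then have "F (osuc \<alpha>) \<le> F \<beta>"
    by (intro monoD[OF assms(1)]) (simp add: osuc_le_iff)
  with assms(2)[of \<alpha>] show "F \<alpha> < F \<beta>" by (rule less_le_trans)
qed

text \<open>Strict growth of \<open>s\<close> is asked only at values of the recursion, because the
  step \<gamma> * \<omega> of the power function fixes 0.\<close>

lemma trans_rec_seq_normal: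
  assumes "\<And>\<gamma>. \<gamma> \<le> s \<gamma>" and "\<And>\<alpha>. trans_rec z s \<alpha> < s (trans_rec z s \<alpha>)"
  shows "seq_normal (trans_rec z s)"
  unfolding seq_normal_def using assms
  by (auto intro!: mono_osuc_less_imp_strict_mono trans_rec_mono trans_rec_seq_continuous
      simp: trans_rec_osuc)

section \<open>Least fixed points as suprema of iterates\<close>

lemma SUP_funpow_fixpoint:
  fixes F :: "'a::infinite ordinal \<Rightarrow> 'a ordinal"
  assumes "seq_normal F"
  shows "F (SUP i. (F ^^ i) \<alpha>) = (SUP i. (F ^^ i) \<alpha>)"
proof (rule antisym)
  \<comment> \<open>Continuity turns an application of \<open>F\<close> into a shift of the sequence
    of iterates by one index.\<close>
  have "F (SUP i. (F ^^ i) \<alpha>) = (SUP i. F ((F ^^ i) \<alpha>))"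
    using assms by (auto simp: seq_normal_def intro: seq_continuousD)
  also have "\<dots> \<le> (SUP i. (F ^^ i) \<alpha>)"
  proof (rule cSUP_least)
    fix i
    show "F ((F ^^ i) \<alpha>) \<le> (SUP i. (F ^^ i) \<alpha>)"
      using le_SUP_ordinal[of "\<lambda>i. (F ^^ i) \<alpha>" "Suc i"] by simp
  qed simp
  finally show "F (SUP i. (F ^^ i) \<alpha>) \<le> (SUP i. (F ^^ i) \<alpha>)" .
  show "(SUP i. (F ^^ i) \<alpha>) \<le> F (SUP i. (F ^^ i) \<alpha>)"
    using assms by (auto simp: seq_normal_def intro: strict_mono_imp_inflationary)
qed

text \<open>By monotonicity, a fixed point above \<alpha> bounds all iterates from \<alpha>. The
  non-strict bound covers both Veblen clauses: \<alpha> = 0 gives the least fixed point, a successor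
  gives the next one.\<close>

lemma Least_fixpoint_ge:
  fixes F :: "'a::infinite ordinal \<Rightarrow> 'a ordinal"
  assumes "seq_normal F"
  shows "(LEAST \<beta>. \<alpha> \<le> \<beta> \<and> F \<beta> = \<beta>) = (SUP i. (F ^^ i) \<alpha>)"
proof (rule Least_equality)
  show "\<alpha> \<le> (SUP i. (F ^^ i) \<alpha>) \<and> F (SUP i. (F ^^ i) \<alpha>) = (SUP i. (F ^^ i) \<alpha>)"
    using SUP_funpow_fixpoint[OF assms] le_SUP_ordinal[of "\<lambda>i. (F ^^ i) \<alpha>" 0] by simp
next
  fix \<beta> assume \<beta>: "\<alpha> \<le> \<beta> \<and> F \<beta> = \<beta>"
  have mono: "mono F" using assms by (simp add: seq_normal_def strict_mono_mono)
  have "(F ^^ i) \<alpha> \<le> \<beta>" for i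
  proof (induction i)
    case (Suc i)
    then show ?case using monoD[OF mono, of "(F ^^ i) \<alpha>" \<beta>] \<beta> by simp
  qed (use \<beta> in simp)
  then show "(SUP i. (F ^^ i) \<alpha>) \<le> \<beta>" by (intro cSUP_least) simp_all
qed

lemma Least_fixpoint_greater:
  fixes F :: "'a::infinite ordinal \<Rightarrow> 'a ordinal"
  assumes "seq_normal F"
  shows "(LEAST \<beta>. \<alpha> < \<beta> \<and> F \<beta> = \<beta>) = (SUP i. (F ^^ i) (osuc \<alpha>))"
  using Least_fixpoint_ge[OF assms, of "osuc \<alpha>"] by (simp add: osuc_le_iff)

lemma Least_fixpoint:
  fixes F :: "'a::infinite ordinal \<Rightarrow> 'a ordinal"
  assumes "seq_normal F"
  shows "(LEAST \<beta>. F \<beta> = \<beta>) = (SUP i. (F ^^ i) 0)"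
  using Least_fixpoint_ge[OF assms, of 0] by simp


section \<open>Ordinal arithmetic\<close>

lemma seq_normal_plus: "seq_normal ((+) \<alpha>)" for \<alpha> :: "'a::infinite ordinal"
proof -
  have "seq_normal (trans_rec \<alpha> osuc)"
    by (rule trans_rec_seq_normal) (simp_all add: less_osuc less_imp_le)
  then show ?thesis by (simp add: plus_ordinal_def[abs_def])
qed

lemma zero_plus_ordinal: "0 + \<alpha> = \<alpha>" for \<alpha> :: "'a::infinite ordinal"
proof (induction \<alpha> rule: less_induct)
  case (less \<alpha>)
  show ?case
  proof (cases \<alpha> rule: ordinal_cases)
    case zero
    then show ?thesis by (simp add: plus_ordinal_simps)
  next
    case (osuc \<beta>)
    with less[of \<beta>] show ?thesis
      by (simp add: less_osuc plus_ordinal_def trans_rec_osuc)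
  next
    case limit
    then have "0 + \<alpha> = (SUP \<gamma>\<in>{..<\<alpha>}. \<gamma>)"
      using less by (simp add: plus_ordinal_simps)
    also have "\<dots> \<le> \<alpha>"
    proof (rule cSUP_least)
      show "{..<\<alpha>} \<noteq> {}"
        using is_limit_pos[OF limit] by blast
    qed auto
    finally have "0 + \<alpha> \<le> \<alpha>" .
    \<comment> \<open>Addition on the right is strictly increasing, hence inflationary.\<close>
    moreover have "\<alpha> \<le> 0 + \<alpha>"
      using seq_normal_plus[of 0] by (auto simp: seq_normal_def intro: strict_mono_imp_inflationary)
    ultimately show ?thesis by (rule antisym)
  qed
qed

lemma le_plus_left_ordinal: "\<gamma> \<le> \<gamma> + \<alpha>" for \<alpha> :: "'a::infinite ordinal"
  using monoD[OF strict_mono_mono, of "(+) \<gamma>" 0 \<alpha>] seq_normal_plus[of \<gamma>]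
  by (simp add: plus_ordinal_simps seq_normal_def)

text \<open>Multiplication by 0 is constant, so monotonicity and continuity take the place of
  normality.\<close>

lemma times_ordinal_mono: "mono ((*) \<alpha>)" for \<alpha> :: "'a::infinite ordinal"
  unfolding times_ordinal_def[abs_def] by (rule trans_rec_mono) (rule le_plus_left_ordinal)

lemma times_ordinal_seq_continuous: "seq_continuous ((*) \<alpha>)" for \<alpha> :: "'a::infinite ordinal"
  unfolding times_ordinal_def[abs_def]
  by (rule trans_rec_seq_continuous) (rule le_plus_left_ordinal)

lemma times_one_ordinal: "\<alpha> * 1 = \<alpha>" for \<alpha> :: "'a::infinite ordinal"
  by (simp add: one_ordinal_def times_ordinal_def trans_rec_osuc trans_rec_zero zero_plus_ordinal)

lemma denote_plus: "denote (\<alpha> + \<beta>) = (denote \<alpha> + denote \<beta> :: 'a::infinite ordinal)"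
proof (induction \<beta>)
  case (Lim \<beta>)
  then show ?case
    using seq_normal_plus[of "denote \<alpha> :: 'a ordinal"] by (simp add: seq_normal_def seq_continuousD)
qed (simp_all add: plus_ordinal_simps)

lemma denote_times: "denote (\<alpha> * \<beta>) = (denote \<alpha> * denote \<beta> :: 'a::infinite ordinal)"
proof (induction \<beta>)
  case (Lim \<beta>)
  then show ?case by (simp add: seq_continuousD[OF times_ordinal_seq_continuous])
qed (simp_all add: times_ordinal_simps denote_plus)

text \<open>The terms 1, 2, 3, ... never reach their supremum, which is therefore a limit; every
  limit exceeds 0 and is closed under successor, so it bounds them all.\<close>

lemma denote_omega: "denote c_omega = (ord_omega :: 'a::infinite ordinal)"
proof -
  let ?n = "\<lambda>i. denote (cord_of_nat i) :: 'a ordinal"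
  let ?L = "SUP i. ?n (Suc i)"
  have "?n (Suc i) < ?L" for i
    using le_SUP_ordinal[of "\<lambda>i. ?n (Suc i)" "Suc i"] less_osuc[of "?n (Suc i)"]
    by (simp add: plus_one_ordinal)
  then have "is_limit ?L" by (rule is_limit_SUP)
  moreover have "?L \<le> \<alpha>" if "is_limit \<alpha>" for \<alpha>
  proof -
    have "?n i < \<alpha>" for i
    proof (induction i)
      case 0
      show ?case
        using is_limit_pos[OF that] by simp
    next
      case (Suc i)
      then have "osuc (?n i) \<le> \<alpha>" by (simp add: osuc_le_iff)
      moreover have "osuc (?n i) \<noteq> \<alpha>" using that by (auto simp: is_limit_def)
      ultimately show ?case by (simp add: plus_one_ordinal)
    qed
    then show ?thesis by (intro cSUP_least less_imp_le) (simp_all del: cord_of_nat.simps)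
  qed
  ultimately have "ord_omega = ?L"
    unfolding ord_omega_def by (rule Least_equality)
  then show ?thesis by (simp add: c_omega_def)
qed

lemma osuc_one_le_omega: "osuc 1 \<le> (ord_omega :: 'a::infinite ordinal)"
proof -
  have "osuc 1 = (denote (cord_of_nat (Suc (Suc 0))) :: 'a ordinal)"
    by (simp add: plus_one_ordinal) (simp add: one_ordinal_def)
  also have "\<dots> \<le> denote c_omega"
    using le_SUP_ordinal[of "\<lambda>i. denote (cord_of_nat (Suc i)) :: 'a ordinal" "Suc 0"]
    by (simp add: c_omega_def)
  finally show ?thesis by (simp add: denote_omega)
qed

text \<open>Gives both growth conditions on the step of the power function: \<gamma> \<le> \<gamma>
  * \<omega> always, and strictly for \<gamma> > 0.\<close>

lemma plus_self_le_times_omega: "\<gamma> + \<gamma> \<le> \<gamma> * ord_omega" for \<gamma> :: "'a::infinite ordinal"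
proof -
  have "\<gamma> + \<gamma> = \<gamma> * osuc 1"
    by (simp add: plus_one_ordinal[symmetric] times_ordinal_simps times_one_ordinal)
  also have "\<dots> \<le> \<gamma> * ord_omega"
    by (rule monoD[OF times_ordinal_mono osuc_one_le_omega])
  finally show ?thesis .
qed

lemma seq_normal_omega_pow: "seq_normal (ord_pow (ord_omega :: 'a::infinite ordinal))"
proof -
  let ?s = "\<lambda>\<gamma>. \<gamma> * ord_omega :: 'a ordinal"
  have le: "\<gamma> \<le> ?s \<gamma>" for \<gamma>
    using le_plus_left_ordinal plus_self_le_times_omega by (rule order_trans)
  have "seq_normal (trans_rec 1 ?s)"
  proof (rule trans_rec_seq_normal[OF le])
    fix \<alpha>
    let ?p = "trans_rec 1 ?s \<alpha>"
    \<comment> \<open>Powers start at 1 and are monotone, so they avoid 0, where the step is not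
      strict.\<close>
    have "1 \<le> ?p"
      using monoD[OF trans_rec_mono[OF le, of 1], of 0 \<alpha>] by (simp add: trans_rec_zero)
    then have "0 < ?p"
      by (simp add: one_ordinal_def osuc_le_iff)
    then have "?p + 0 < ?p + ?p"
      using seq_normal_plus[of ?p] by (auto simp: seq_normal_def dest: strict_monoD)
    then show "?p < ?s ?p"
      using plus_self_le_times_omega[of ?p] by (simp add: plus_ordinal_simps)
  qed
  then show ?thesis by (simp add: ord_pow_def[abs_def])
qed

lemma denote_omega_pow:
  "denote (c_pow c_omega \<alpha>) = ord_pow (ord_omega :: 'a::infinite ordinal) (denote \<alpha>)"
proof (induction \<alpha>)
  case (Lim \<alpha>)
  then show ?case
    using seq_normal_omega_pow[where 'a = 'a] by (simp add: seq_normal_def seq_continuousD)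
qed (simp_all add: ord_pow_simps denote_times denote_omega zero_plus_ordinal)


section \<open>Veblen functions\<close>

lemma seq_normal_veblen: "seq_normal (veblen k :: 'a::infinite ordinal \<Rightarrow> 'a ordinal)"
proof (induction k)
  case 0
  show ?case by (simp add: seq_normal_omega_pow)
next
  case (Suc k)
  \<comment> \<open>Normality at level \<open>k\<close> makes this fixed point exist as a supremum
    of iterates, whose zeroth term \<open>osuc \<gamma>\<close> is already above \<gamma>.\<close>
  have less: "\<gamma> < (LEAST \<beta>. \<gamma> < \<beta> \<and> veblen k \<beta> = \<beta>)" for \<gamma> :: "'a ordinal"
    using le_SUP_ordinal[of "\<lambda>i. (veblen k ^^ i) (osuc \<gamma>)" 0]
    by (simp add: Least_fixpoint_greater[OF Suc] osuc_le_iff)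
  show ?case
    unfolding veblen.simps by (rule trans_rec_seq_normal) (simp_all add: less less_imp_le)
qed

theorem theorem6p5:
  fixes k :: nat and \<alpha> :: cord
  shows "(denote (c_veblen k \<alpha>) :: 'a::infinite ordinal) = veblen k (denote \<alpha>)"
proof (induction k arbitrary: \<alpha>)
  case 0
  show ?case by (simp add: denote_omega_pow)
next
  case (Suc k)
  \<comment> \<open>The hypothesis on \<open>k\<close> holds for every term, so it applies to each
    successive iterate.\<close>
  have iter: "denote ((c_veblen k ^^ i) \<beta>) = (veblen k ^^ i) (denote \<beta> :: 'a ordinal)" for i \<beta>
    by (induction i) (simp_all add: Suc)
  show ?case
  proof (induction \<alpha>)
    case Zero
    show ?case
      unfolding c_veblen_simps denote.simps veblen_simps
      by (simp add: iter Least_fixpoint[OF seq_normal_veblen])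
  next
    case (Succ \<alpha>)
    then show ?case
      unfolding c_veblen_simps denote.simps veblen_simps
      by (simp only: iter denote.simps plus_one_ordinal Least_fixpoint_greater[OF seq_normal_veblen])
  next
    case (Lim \<alpha>)
    \<comment> \<open>Continuity at level \<open>Suc k\<close> itself is what matches the
      constructive limit clause, for any sequence inside \<open>Lim\<close>.\<close>
    have "seq_continuous (veblen (Suc k) :: 'a ordinal \<Rightarrow> 'a ordinal)"
      using seq_normal_veblen[of "Suc k"] unfolding seq_normal_def ..
    from seq_continuousD[OF this] Lim show ?case
      unfolding c_veblen_simps denote.simps by simp
  qed
qed

end
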